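(* Let $d\ge 1$, $I^d=[0,1]^d$, let $u:I^d\to\mathbb{R}$, and for every mesh vector $\mathbf{h}=(h_1,\dots,h_d)$ whose entries are powers $h_j=2^{-l_j}$, $l_j\in\mathbb{N}_0$, let $u_{\mathbf{h}}:I^d\to\mathbb{R}$ be an approximation of $u$. Assume there exist functions $\beta_j\in L^\infty(I^d\times[0,1]^{d-1})$ for $1\le j\le d$ and $\gamma_{j_1,\dots,j_m}\in L^\infty(I^d\times[0,1]^m)$ for every $1\le m\le d$ and every subset $\{j_1,\dots,j_m\}\subset\{1,\dots,d\}$ of size $m$, with $\|\gamma_{j_1,\dots,j_m}\|_\infty\le K$, such that $$u-u_{\mathbf{h}}=\sum_{j=1}^d \beta_j(\cdot;h_1,\dots,h_{j-1},h_{j+1},\dots,h_d)\,h_j^2+\sum_{m=1}^d\ \sum_{\{j_1,\dots,j_m\}\subset\{1,\dots,d\}}\gamma_{j_1,\dots,j_m}(\cdot;h_{j_1},\dots,h_{j_m})\,h_{j_1}^4\cdots h_{j_m}^4$$ for all such $\mathbf{h}$. Then, for every $n\in\mathbb{N}_0$, the higher order combination solution $\hat u_n$ (defined in the context) satisfies, pointwise on $I^d$, $$|u-\hat u_n|\le \frac{10}{3}\,\frac{K}{(d-1)!}\left(\frac{85}{24}\right)^{d-1}(n+2d-1)^{d-1}\,2^{-4n}.$$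
   Context: In the application, $u_{\mathbf{h}}$ is the piecewise multilinear interpolant of a finite difference solution on the tensor product grid with mesh sizes $\mathbf{h}$; only the stated expansion is used as a hypothesis. Extrapolated solution: $$\tilde u_{\mathbf{h}}=\sum_{k=0}^d\alpha_k\sum_{\{i_1,\dots,i_k\}\subset\{1,\dots,d\}}u_{\mathbf{h}}^{(i_1,\dots,i_k)},\qquad \alpha_k=\frac{(-4)^k}{(-3)^d},$$ where the inner sum runs over subsets of size $k$, and $u_{\mathbf{h}}^{(i_1,\dots,i_k)}:=u_{\mathbf{h}'}$ with $h'_j=h_j/2$ if $j\in\{i_1,\dots,i_k\}$ and $h'_j=h_j$ otherwise. Higher order combination solution at level $n$: $$\hat u_n=\sum_{l=n}^{n+d-1}a_{l-n}\sum_{\mathbf{j}\in\mathbb{N}_0^d,\ |\mathbf{j}|=l}\tilde u_{2^{-\mathbf{j}}},\qquad a_i=(-1)^{d-1-i}\binom{d-1}{i},\quad 0\le i\le d-1,$$ where $|\mathbf{j}|=j_1+\dots+j_d$ and $2^{-\mathbf{j}}=(2^{-j_1},\dots,2^{-j_d})$. Since the functions are evaluated at individual points and individual mesh sizes, $L^\infty(X)$ means the space of bounded real functions on $X$ and $\|\cdot\|_\infty$ is the supremum norm; identities between functions on $I^d$ hold pointwise. *)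

theory Defs
  imports "HOL-Analysis.Analysis"
begin

text \<open>
  Vectors indexed by a finite set \<open>S\<close> of naturals are the extensional functions on \<open>S\<close>.
  In particular \<open>[0,1]\<^sup>m\<close>, as the range of the variables \<open>(h\<^bsub>j1\<^esub>, \<dots>, h\<^bsub>jm\<^esub>)\<close>, is
  \<open>unit_cube {j1, \<dots>, jm}\<close>: the coordinates keep their original names instead of being
  renumbered by \<open>1, \<dots>, m\<close>.
\<close>

definition unit_cube :: "nat set \<Rightarrow> (nat \<Rightarrow> real) set" where
  "unit_cube S = (\<Pi>\<^sub>E i\<in>S. {0..1})"

definition mesh_vectors :: "nat \<Rightarrow> (nat \<Rightarrow> real) set" where
  "mesh_vectors d = (\<Pi>\<^sub>E i\<in>{1..d}. {2 powi (- int l) | l. True})"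

text \<open>Bounded everywhere, not merely almost everywhere, and without measurability.\<close>

definition Linfty :: "'a set \<Rightarrow> ('a \<Rightarrow> real) set" where
  "Linfty X = {f. bounded (f ` X)}"

definition sup_norm :: "'a set \<Rightarrow> ('a \<Rightarrow> real) \<Rightarrow> real" where
  "sup_norm X f = (SUP x\<in>X. \<bar>f x\<bar>)"

definition subsets_of_card :: "nat \<Rightarrow> nat \<Rightarrow> nat set set" where
  "subsets_of_card d k = {S. S \<subseteq> {1..d} \<and> card S = k}"

definition halve_mesh :: "nat \<Rightarrow> nat set \<Rightarrow> (nat \<Rightarrow> real) \<Rightarrow> nat \<Rightarrow> real" where
  "halve_mesh d S h = (\<lambda>j\<in>{1..d}. if j \<in> S then h j / 2 else h j)"

definition extrapolation_coeff :: "nat \<Rightarrow> nat \<Rightarrow> real" where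
  "extrapolation_coeff d k = (- 4) ^ k / (- 3) ^ d"

definition extrapolated ::
  "nat \<Rightarrow> ((nat \<Rightarrow> real) \<Rightarrow> (nat \<Rightarrow> real) \<Rightarrow> real) \<Rightarrow> (nat \<Rightarrow> real) \<Rightarrow> (nat \<Rightarrow> real) \<Rightarrow> real" where
  "extrapolated d uh h x =
     (\<Sum>k=0..d. extrapolation_coeff d k * (\<Sum>S\<in>subsets_of_card d k. uh (halve_mesh d S h) x))"

definition multi_indices :: "nat \<Rightarrow> nat \<Rightarrow> (nat \<Rightarrow> nat) set" where
  "multi_indices d l = {j \<in> {1..d} \<rightarrow>\<^sub>E UNIV. (\<Sum>i=1..d. j i) = l}"

definition dyadic_mesh :: "nat \<Rightarrow> (nat \<Rightarrow> nat) \<Rightarrow> nat \<Rightarrow> real" where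
  "dyadic_mesh d j = (\<lambda>i\<in>{1..d}. 2 powi (- int (j i)))"

definition combination_coeff :: "nat \<Rightarrow> nat \<Rightarrow> real" where
  "combination_coeff d i = (- 1) ^ (d - 1 - i) * real ((d - 1) choose i)"

definition combination_solution ::
  "nat \<Rightarrow> ((nat \<Rightarrow> real) \<Rightarrow> (nat \<Rightarrow> real) \<Rightarrow> real) \<Rightarrow> nat \<Rightarrow> (nat \<Rightarrow> real) \<Rightarrow> real" where
  "combination_solution d uh n x =
     (\<Sum>l=n..n+d-1. combination_coeff d (l - n) *
        (\<Sum>j\<in>multi_indices d l. extrapolated d uh (dyadic_mesh d j) x))"

end

theory Submission
  imports Defs
begin

text \<open>
  The extrapolation is the tensor product of the one-dimensional rules \<open>(4 f(h/2) - f(h)) / 3\<close>.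
  Each factor preserves constants and kills \<open>h\<^sup>2\<close>, so the \<open>\<beta>\<close>-terms vanish and the \<open>\<gamma>\<close>-term of
  a set \<open>S\<close> with \<open>m\<close> elements becomes a function of the coordinates in \<open>S\<close> only, bounded by
  \<open>K (5/12)\<^sup>m\<close> times the product of the \<open>h\<^sub>j\<^sup>4\<close>.
  The combination is the \<open>(d - 1)\<close>-st forward difference at \<open>n\<close> of the sums over \<open>|j| = l\<close>; summing
  out the \<open>d - m\<close> coordinates outside \<open>S\<close> cancels as many differences. What remains is an
  \<open>(m - 1)\<close>-st difference at \<open>n + d - m\<close>, which is estimated termwise. The outcome is far below the
  claimed bound, so the last estimates can afford to be crude.
\<close>

section \<open>Iterated forward differences\<close>

text \<open>The innermost difference is taken first: one unfolding on a function given by partial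
  sums then leaves the summand at the next argument.\<close>

primrec forward_diff :: "nat \<Rightarrow> (nat \<Rightarrow> real) \<Rightarrow> nat \<Rightarrow> real" where
  "forward_diff 0 f = f"
| "forward_diff (Suc k) f = forward_diff k (\<lambda>n. f (Suc n) - f n)"

lemma forward_diff_shift: "forward_diff k (\<lambda>n. f (Suc n)) n = forward_diff k f (Suc n)"
  by (induction k arbitrary: f) auto

text \<open>Binomial expansion of the k-th power of (shift minus identity). For k = d - 1 its
  weights are exactly \<open>combination_coeff d\<close>.\<close>

lemma forward_diff_eq_sum:
  "forward_diff k f n = (\<Sum>i\<le>k. (- 1) ^ (k - i) * real (k choose i) * f (n + i))"
proof -
  \<comment> \<open>The sign exponent k + i has the parity of k - i and keeps truncated subtraction
    out of the induction.\<close>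
  have "forward_diff k f n = (\<Sum>i\<le>k. (- 1) ^ (k + i) * real (k choose i) * f (n + i))"
  proof (induction k arbitrary: f)
    case (Suc k)
    define c where "c i = (- 1) ^ (k + i) * real (k choose i)" for i
    \<comment> \<open>Pascal's rule with the alternating sign absorbed in \<open>c\<close>.\<close>
    have c_Suc: "(- 1) ^ (Suc k + Suc i) * real (Suc k choose Suc i) = c i - c (Suc i)" for i
      by (simp add: c_def algebra_simps)
    have "forward_diff (Suc k) f n = (\<Sum>i\<le>k. c i * (f (Suc n + i) - f (n + i)))"
      by (simp add: Suc.IH c_def)
    \<comment> \<open>The second sum may run up to Suc k because \<open>c (Suc k)\<close> =
      0.\<close>
    also have "\<dots> = (\<Sum>i\<le>k. c i * f (n + Suc i)) - (\<Sum>i\<le>Suc k. c i * f (n + i))"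
      by (simp add: right_diff_distrib sum_subtractf c_def)
    also have "\<dots> = - c 0 * f n + (\<Sum>i\<le>k. (c i - c (Suc i)) * f (n + Suc i))"
      by (simp only: sum.atMost_Suc_shift) (simp add: left_diff_distrib sum_subtractf)
    also have "\<dots> = (\<Sum>i\<le>Suc k. (- 1) ^ (Suc k + i) * real (Suc k choose i) * f (n + i))"
      by (simp only: sum.atMost_Suc_shift c_Suc) (simp add: c_def)
    finally show ?case .
  qed simp
  also have "\<dots> = (\<Sum>i\<le>k. (- 1) ^ (k - i) * real (k choose i) * f (n + i))"
    by (intro sum.cong refl) (auto simp: minus_one_power_iff)
  finally show ?thesis .
qed

section \<open>Multi-indices of given total over an arbitrary finite index set\<close>

definition weak_compositions :: "'a set \<Rightarrow> nat \<Rightarrow> ('a \<Rightarrow> nat) set" where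
  "weak_compositions A l = {j \<in> A \<rightarrow>\<^sub>E UNIV. (\<Sum>i\<in>A. j i) = l}"

lemma finite_weak_compositions:
  assumes "finite A"
  shows "finite (weak_compositions A l)"
proof (rule finite_subset)
  show "weak_compositions A l \<subseteq> A \<rightarrow>\<^sub>E {..l}"
    using assms by (auto simp: weak_compositions_def PiE_iff extensional_def intro: member_le_sum)
qed (use assms in \<open>auto intro: finite_PiE\<close>)

text \<open>The entry at a is forced to be l - k once the entries over A sum to k, and the summand
  does not see it.\<close>

lemma sum_weak_compositions_insert:
  fixes g :: "('a \<Rightarrow> nat) \<Rightarrow> real"
  assumes "finite A" "a \<notin> A"
  shows "(\<Sum>j\<in>weak_compositions (insert a A) l. g (restrict j A)) =
    (\<Sum>k\<le>l. \<Sum>j\<in>weak_compositions A k. g j)"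
proof -
  have "(\<Sum>k\<le>l. \<Sum>j\<in>weak_compositions A k. g j) =
      (\<Sum>(k, j)\<in>(SIGMA k:{..l}. weak_compositions A k). g j)"
    by (rule sum.Sigma) (auto simp: finite_weak_compositions assms)
  also have "\<dots> = (\<Sum>j\<in>weak_compositions (insert a A) l. g (restrict j A))"
  proof (rule sum.reindex_bij_witness
      [where i = "\<lambda>j. (\<Sum>i\<in>A. j i, restrict j A)" and j = "\<lambda>(k, j). j(a := l - k)"])
    fix p assume p: "p \<in> (SIGMA k:{..l}. weak_compositions A k)"
    obtain k j where [simp]: "p = (k, j)" by (cases p)
    have j: "k \<le> l" "j \<in> A \<rightarrow>\<^sub>E UNIV" "(\<Sum>i\<in>A. j i) = k"
      using p by (auto simp: weak_compositions_def)
    have s: "(\<Sum>i\<in>A. (j(a := l - k)) i) = k"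
      using j(3) assms(2) by (metis (mono_tags, lifting) fun_upd_other sum.cong)
    have r: "restrict (j(a := l - k)) A = j"
      using j(2) assms(2) by (auto simp: restrict_def PiE_iff extensional_def fun_eq_iff)
    show "(\<lambda>j. (\<Sum>i\<in>A. j i, restrict j A)) (case p of (k, j) \<Rightarrow> j(a := l - k)) = p"
      using s r by simp
    show "(case p of (k, j) \<Rightarrow> j(a := l - k)) \<in> weak_compositions (insert a A) l"
      using s j assms by (auto simp: weak_compositions_def PiE_iff extensional_def)
    show "g (restrict (case p of (k, j) \<Rightarrow> j(a := l - k)) A) = (case p of (k, j) \<Rightarrow> g j)"
      using r by simp
  next
    fix j assume "j \<in> weak_compositions (insert a A) l"
    then have j: "j \<in> insert a A \<rightarrow>\<^sub>E UNIV" "j a + (\<Sum>i\<in>A. j i) = l"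
      using assms by (auto simp: weak_compositions_def)
    show "(case (\<Sum>i\<in>A. j i, restrict j A) of (k, j) \<Rightarrow> j(a := l - k)) = j"
      using j by (auto simp: fun_eq_iff PiE_iff extensional_def)
    show "(\<Sum>i\<in>A. j i, restrict j A) \<in> (SIGMA k:{..l}. weak_compositions A k)"
      using j by (auto simp: weak_compositions_def)
  qed
  finally show ?thesis ..
qed

text \<open>Stars and bars: adding an index sums the counts of all levels up to l (the previous
  lemma with summand 1), and the hockey-stick identity evaluates this sum.\<close>

lemma card_weak_compositions:
  assumes "finite A" "A \<noteq> {}"
  shows "real (card (weak_compositions A l)) = real ((l + card A - 1) choose (card A - 1))"
  using assms
proof (induction A arbitrary: l rule: finite_ne_induct)
  case (singleton a)
  have "weak_compositions {a} l = {\<lambda>i\<in>{a}. l}"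
    by (auto simp: weak_compositions_def PiE_iff extensional_def fun_eq_iff)
  then show ?case by simp
next
  case (insert a A)
  then obtain m where m: "card A = Suc m"
    by (metis card_gt_0_iff gr0_implies_Suc)
  have "real (card (weak_compositions (insert a A) l)) = (\<Sum>k\<le>l. real (card (weak_compositions A k)))"
    using sum_weak_compositions_insert[OF insert.hyps(1) insert.hyps(3), of "\<lambda>_. 1" l] by simp
  also have "\<dots> = real (\<Sum>k\<le>l. (m + k) choose m)"
    using insert.IH m by (simp add: add.commute)
  also have "(\<Sum>k\<le>l. (m + k) choose m) = (l + Suc m) choose Suc m"
    using choose_rising_sum(1)[of m l] by (simp add: add.commute)
  finally show ?case using insert.hyps m by simp
qed

text \<open>Summing out a coordinate on which the summand does not depend is a partial summation
  in \<open>l\<close>, which cancels one difference operator.\<close>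

lemma forward_diff_weak_compositions_Un:
  fixes g :: "('a \<Rightarrow> nat) \<Rightarrow> real"
  assumes "finite B" "finite S" "S \<noteq> {}" "S \<inter> B = {}"
  shows "forward_diff (card S + card B - 1)
      (\<lambda>l. \<Sum>j\<in>weak_compositions (S \<union> B) l. g (restrict j S)) n =
    forward_diff (card S - 1) (\<lambda>l. \<Sum>j\<in>weak_compositions S l. g j) (n + card B)"
  using assms
proof (induction B arbitrary: n rule: finite_induct)
  case empty
  have "restrict j S = j" if "j \<in> weak_compositions S l" for j l
    using that by (auto simp: weak_compositions_def PiE_restrict)
  then show ?case by simp
next
  case (insert b B)
  let ?F = "\<lambda>A l. \<Sum>j\<in>weak_compositions A l. g (restrict j S)"
  have partial_sum: "?F (S \<union> insert b B) l = (\<Sum>k\<le>l. ?F (S \<union> B) k)" for l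
    using sum_weak_compositions_insert[of "S \<union> B" b "\<lambda>j. g (restrict j S)" l] insert
    by (simp add: Int_absorb1 Int_absorb2 Int_commute)
  \<comment> \<open>As S is nonempty, the truncated subtraction is exact and one difference is
    available for b.\<close>
  have "card S > 0" using insert.prems by (simp add: card_gt_0_iff)
  then have "card S + card (insert b B) - 1 = Suc (card S + card B - 1)"
    using insert.hyps by simp
  \<comment> \<open>The difference of partial sums at l is the summand at l + 1; hence each
    cancelled coordinate moves the base point up by one.\<close>
  then have "forward_diff (card S + card (insert b B) - 1) (?F (S \<union> insert b B)) n =
      forward_diff (card S + card B - 1) (\<lambda>l. ?F (S \<union> B) (Suc l)) n"
    unfolding partial_sum by simp
  also have "\<dots> = forward_diff (card S + card B - 1) (?F (S \<union> B)) (Suc n)"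
    by (rule forward_diff_shift)
  also have "\<dots> = forward_diff (card S - 1) (\<lambda>l. \<Sum>j\<in>weak_compositions S l. g j) (Suc n + card B)"
    using insert.prems by (intro insert.IH) auto
  finally show ?case using insert.hyps by (simp add: restrict_def)
qed

lemma forward_diff_weak_compositions:
  fixes g :: "('a \<Rightarrow> nat) \<Rightarrow> real"
  assumes "finite A" "S \<subseteq> A" "S \<noteq> {}"
  shows "forward_diff (card A - 1) (\<lambda>l. \<Sum>j\<in>weak_compositions A l. g (restrict j S)) n =
    forward_diff (card S - 1) (\<lambda>l. \<Sum>j\<in>weak_compositions S l. g j) (n + card (A - S))"
proof -
  have fin: "finite S" using assms finite_subset by blast
  have "A = S \<union> (A - S)" using assms by blast
  moreover from this have "card A = card S + card (A - S)"
    using card_Un_disjoint[of S "A - S"] fin assms(1) by auto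
  ultimately show ?thesis
    using forward_diff_weak_compositions_Un[of "A - S" S g n] fin assms by auto
qed

section \<open>Growth and decay estimates\<close>

text \<open>The quotient of consecutive terms is N / (m + 1), at least 1 as long as m < N.\<close>

lemma power_over_fact_mono:
  assumes "k \<le> m" "m \<le> N"
  shows "real N ^ k / fact k \<le> real N ^ m / fact m"
  using assms
proof (induction m rule: dec_induct)
  case (step m)
  have "real N ^ m / fact m * 1 \<le> real N ^ m / fact m * (real N / real (Suc m))"
    using step.prems by (intro mult_left_mono) auto
  also have "\<dots> = real N ^ Suc m / fact (Suc m)" by (simp add: mult_ac)
  finally show ?case using step by simp
qed simp

text \<open>Gives the binomials belonging to sets S of different sizes one common bound, with the
  exponent d - 1 of the claim.\<close>

lemma binomial_le_power_over_fact:
  assumes "a \<le> N" "k \<le> m" "m \<le> N"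
  shows "real (a choose k) \<le> real N ^ m / fact m"
proof -
  have "real (a choose k) * fact k \<le> real a ^ k"
    using binomial_fact_pow[of a k] by (metis of_nat_fact of_nat_le_iff of_nat_mult of_nat_power)
  then have "real (a choose k) \<le> real a ^ k / fact k" by (simp add: field_simps)
  also have "\<dots> \<le> real N ^ k / fact k"
    using assms by (intro divide_right_mono power_mono) auto
  also have "\<dots> \<le> real N ^ m / fact m" using assms by (intro power_over_fact_mono)
  finally show ?thesis .
qed

text \<open>The triangle inequality discards the signs; the binomial theorem then sums the geometric
  bounds.\<close>

lemma abs_forward_diff_geometric_le:
  assumes "0 \<le> r" "\<And>i. i \<le> k \<Longrightarrow> \<bar>f (n + i)\<bar> \<le> C * r ^ i"
  shows "\<bar>forward_diff k f n\<bar> \<le> C * (1 + r) ^ k"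
proof -
  have "\<bar>forward_diff k f n\<bar> \<le> (\<Sum>i\<le>k. real (k choose i) * \<bar>f (n + i)\<bar>)"
    unfolding forward_diff_eq_sum by (rule order_trans[OF sum_abs]) (simp add: abs_mult power_abs)
  also have "\<dots> \<le> (\<Sum>i\<le>k. real (k choose i) * (C * r ^ i))"
    using assms by (intro sum_mono mult_left_mono) auto
  also have "\<dots> = C * (\<Sum>i\<le>k. real (k choose i) * r ^ i * 1 ^ (k - i))"
    by (simp add: sum_distrib_left mult_ac)
  also have "\<dots> = C * (1 + r) ^ k"
    unfolding add.commute[of 1 r] binomial_ring[of r 1] by simp
  finally show ?thesis .
qed

section \<open>Weighted sums over subsets\<close>

lemma sum_Pow_insert:
  fixes f :: "'a set \<Rightarrow> real"
  assumes "finite A" "a \<notin> A"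
  shows "(\<Sum>T\<in>Pow (insert a A). f T) = (\<Sum>T\<in>Pow A. f T + f (insert a T))"
proof -
  have "inj_on (insert a) (Pow A)" using assms(2) by (auto intro!: inj_onI)
  then show ?thesis
    using assms unfolding Pow_insert
    by (subst sum.union_disjoint) (auto simp: sum.reindex sum.distrib)
qed

text \<open>An element outside S is invisible to \<phi>, so its absence and presence together
  contribute a factor 1 + c. For c = -4 this is -3, the base of the extrapolation
  denominator.\<close>

lemma sum_Pow_power_card_Int:
  fixes c :: real
  assumes "finite A" "S \<subseteq> A"
  shows "(\<Sum>T\<in>Pow A. c ^ card T * \<phi> (T \<inter> S)) =
    (1 + c) ^ card (A - S) * (\<Sum>T\<in>Pow S. c ^ card T * \<phi> T)"
proof -
  have "(\<Sum>T\<in>Pow (S \<union> B). c ^ card T * \<phi> (T \<inter> S)) =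
      (1 + c) ^ card B * (\<Sum>T\<in>Pow S. c ^ card T * \<phi> T)"
    if "finite B" "B \<inter> S = {}" for B
    using that
  proof (induction B rule: finite_induct)
    case empty
    show ?case by (auto intro!: sum.cong simp: Int_absorb2)
  next
    case (insert b B)
    have fin: "finite S" using assms finite_subset by blast
    have step: "c ^ card (insert b T) * \<phi> (insert b T \<inter> S) = c * (c ^ card T * \<phi> (T \<inter> S))"
      if "T \<in> Pow (S \<union> B)" for T
    proof -
      have "finite T" "b \<notin> T"
        using that insert fin by (auto dest: finite_subset)
      then show ?thesis using insert.prems by simp
    qed
    have "(\<Sum>T\<in>Pow (insert b (S \<union> B)). c ^ card T * \<phi> (T \<inter> S)) =
        (\<Sum>T\<in>Pow (S \<union> B). c ^ card T * \<phi> (T \<inter> S) + c ^ card (insert b T) * \<phi> (insert b T \<inter> S))"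
      using insert.hyps insert.prems fin by (intro sum_Pow_insert) auto
    also have "\<dots> = (\<Sum>T\<in>Pow (S \<union> B). c ^ card T * \<phi> (T \<inter> S) + c * (c ^ card T * \<phi> (T \<inter> S)))"
      by (intro sum.cong refl arg_cong2[where f = "(+)"] step)
    also have "\<dots> = (1 + c) * (\<Sum>T\<in>Pow (S \<union> B). c ^ card T * \<phi> (T \<inter> S))"
      by (simp add: sum.distrib sum_distrib_left distrib_right)
    also have "\<dots> = (1 + c) * ((1 + c) ^ card B * (\<Sum>T\<in>Pow S. c ^ card T * \<phi> T))"
      using insert by simp
    finally show ?case using insert.hyps by simp
  qed
  from this[of "A - S"] show ?thesis
    using assms by (simp add: Un_absorb1 Diff_Int_distrib2)
qed

lemma sum_Pow_power_card:
  fixes c :: real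
  assumes "finite A"
  shows "(\<Sum>T\<in>Pow A. c ^ card T) = (1 + c) ^ card A"
  using sum_Pow_power_card_Int[OF assms, of "{}" c "\<lambda>_. 1"] by simp

text \<open>Used with a = 0 for the extrapolation and with a = 1 for the remainder terms.\<close>

lemma sum_subsets_of_card:
  fixes f :: "nat set \<Rightarrow> real"
  shows "(\<Sum>m=a..d. \<Sum>S\<in>subsets_of_card d m. f S) = (\<Sum>S | S \<subseteq> {1..d} \<and> a \<le> card S. f S)"
proof -
  have fin: "finite (subsets_of_card d m)" for m
    by (rule finite_subset[of _ "Pow {1..d}"]) (auto simp: subsets_of_card_def)
  have "card S \<le> d" if "S \<subseteq> {1..d}" for S
    using card_mono[OF _ that] by simp
  then have "{S. S \<subseteq> {1..d} \<and> a \<le> card S} = (\<Union>m\<in>{a..d}. subsets_of_card d m)"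
    by (auto simp: subsets_of_card_def)
  then show ?thesis
    by (simp only:) (rule sum.UNION_disjoint[symmetric], auto simp: fin, auto simp: subsets_of_card_def)
qed

section \<open>Algebra of the extrapolation operator\<close>

lemma extrapolated_eq_sum_Pow:
  "extrapolated d F h x =
    (\<Sum>T\<in>Pow {1..d}. (- 4) ^ card T * F (halve_mesh d T h) x) / (- 3) ^ d"
proof -
  have "extrapolated d F h x = (\<Sum>k=0..d. \<Sum>T\<in>subsets_of_card d k.
      (- 4) ^ card T / (- 3) ^ d * F (halve_mesh d T h) x)"
    unfolding extrapolated_def extrapolation_coeff_def sum_distrib_left
    by (intro sum.cong refl) (auto simp: subsets_of_card_def)
  then show ?thesis
    by (simp add: sum_subsets_of_card sum_divide_distrib Pow_def)
qed

lemma extrapolated_cong: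
  assumes "\<And>T. T \<subseteq> {1..d} \<Longrightarrow> F (halve_mesh d T h) x = G (halve_mesh d T h) x"
  shows "extrapolated d F h x = extrapolated d G h x"
  using assms by (simp add: extrapolated_eq_sum_Pow)

lemma extrapolated_add:
  "extrapolated d (\<lambda>h x. F h x + G h x) h x = extrapolated d F h x + extrapolated d G h x"
  by (simp add: extrapolated_eq_sum_Pow distrib_left sum.distrib add_divide_distrib)

lemma extrapolated_diff:
  "extrapolated d (\<lambda>h x. F h x - G h x) h x = extrapolated d F h x - extrapolated d G h x"
  by (simp add: extrapolated_eq_sum_Pow right_diff_distrib sum_subtractf diff_divide_distrib)

lemma extrapolated_sum:
  "extrapolated d (\<lambda>h x. \<Sum>i\<in>I. F i h x) h x = (\<Sum>i\<in>I. extrapolated d (F i) h x)"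
  unfolding extrapolated_eq_sum_Pow sum_distrib_left sum_divide_distrib by (rule sum.swap)

text \<open>The weights sum to (1 - 4)^d / (-3)^d = 1.\<close>

lemma extrapolated_const: "extrapolated d (\<lambda>_. f) h x = f x"
  by (simp add: extrapolated_eq_sum_Pow sum_Pow_power_card flip: sum_distrib_right)

text \<open>Pair T with \<open>insert i T\<close>: the weight gains a factor -4, the squared mesh
  size a factor 1/4, and \<open>b\<close> does not see coordinate i, so each pair cancels.\<close>

lemma extrapolated_square_eq_0:
  assumes "i \<in> {1..d}"
  shows "extrapolated d (\<lambda>h x. b x (restrict h ({1..d} - {i})) * h i ^ 2) h x = 0"
proof -
  define A where "A = {1..d} - {i}"
  have A: "finite A" "i \<notin> A" "insert i A = {1..d}" using assms by (auto simp: A_def)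
  let ?f = "\<lambda>T. (- 4) ^ card T * (b x (restrict (halve_mesh d T h) A) * halve_mesh d T h i ^ 2)"
  have "?f T + ?f (insert i T) = 0" if "T \<subseteq> A" for T
  proof -
    have "finite T" "i \<notin> T" using that A finite_subset by auto
    moreover have "restrict (halve_mesh d (insert i T) h) A = restrict (halve_mesh d T h) A"
      by (auto simp: A_def restrict_def halve_mesh_def fun_eq_iff)
    ultimately show ?thesis
      using assms by (simp add: halve_mesh_def power_divide)
  qed
  then have "(\<Sum>T\<in>Pow {1..d}. ?f T) = 0"
    using sum_Pow_insert[OF A(1,2), of ?f] A(3) by (simp add: sum.neutral)
  then show ?thesis
    unfolding extrapolated_eq_sum_Pow A_def[symmetric] by (simp only: div_0)
qed

text \<open>Every coordinate outside S contributes 1 - 4 = -3 to the numerator and cancels one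
  factor of the denominator.\<close>

lemma extrapolated_restrict:
  assumes "S \<subseteq> {1..d}"
  shows "extrapolated d (\<lambda>h x. c x (restrict h S)) h x =
    (\<Sum>T\<in>Pow S. (- 4) ^ card T * c x (restrict (halve_mesh d T h) S)) / (- 3) ^ card S"
proof -
  let ?\<phi> = "\<lambda>T. c x (restrict (halve_mesh d T h) S)"
  have "restrict (halve_mesh d T h) S = restrict (halve_mesh d (T \<inter> S) h) S" for T
    by (auto simp: restrict_def halve_mesh_def fun_eq_iff)
  then have "extrapolated d (\<lambda>h x. c x (restrict h S)) h x =
      (\<Sum>T\<in>Pow {1..d}. (- 4) ^ card T * ?\<phi> (T \<inter> S)) / (- 3) ^ d"
    unfolding extrapolated_eq_sum_Pow by metis
  also have "\<dots> = (- 3) ^ card ({1..d} - S) * (\<Sum>T\<in>Pow S. (- 4) ^ card T * ?\<phi> T) / (- 3) ^ d"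
    using assms by (subst sum_Pow_power_card_Int) auto
  also have "(- 3 :: real) ^ d = (- 3) ^ card ({1..d} - S) * (- 3) ^ card S"
    using assms card_mono[OF _ assms] by (simp add: card_Diff_subset finite_subset flip: power_add)
  also have "(- 3) ^ card ({1..d} - S) * (\<Sum>T\<in>Pow S. (- 4) ^ card T * ?\<phi> T) /
      ((- 3) ^ card ({1..d} - S) * (- 3) ^ card S) = (\<Sum>T\<in>Pow S. (- 4) ^ card T * ?\<phi> T) / (- 3) ^ card S"
    by simp
  finally show ?thesis .
qed

section \<open>Extrapolated remainder terms on dyadic meshes\<close>

lemma halve_mesh_dyadic_mesh:
  "halve_mesh d T (dyadic_mesh d j) = dyadic_mesh d (\<lambda>i. j i + of_bool (i \<in> T))"
  by (auto simp: halve_mesh_def dyadic_mesh_def fun_eq_iff power_int_diff)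

lemma dyadic_mesh_in_mesh_vectors: "dyadic_mesh d j \<in> mesh_vectors d"
  by (auto simp: dyadic_mesh_def mesh_vectors_def)

lemma dyadic_mesh_in_unit_cube:
  assumes "S \<subseteq> {1..d}"
  shows "restrict (dyadic_mesh d j) S \<in> unit_cube S"
  using assms
  by (auto simp: dyadic_mesh_def unit_cube_def power_int_minus inverse_le_1_iff)

lemma prod_dyadic_mesh_power4:
  assumes "S \<subseteq> {1..d}"
  shows "(\<Prod>i\<in>S. dyadic_mesh d j i ^ 4) = (1 / 16) ^ (\<Sum>i\<in>S. j i)"
proof -
  have "dyadic_mesh d j i ^ 4 = (1 / 16) ^ j i" if "i \<in> S" for i
  proof -
    have "dyadic_mesh d j i ^ 4 = ((1 / 2) ^ j i) ^ 4"
      using that assms by (auto simp: dyadic_mesh_def power_int_minus power_one_over inverse_eq_divide)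
    also have "\<dots> = ((1 / 2) ^ 4) ^ j i"
      unfolding power_mult[symmetric] mult.commute[of 4] by (rule refl)
    finally show ?thesis by (simp add: power_divide)
  qed
  then show ?thesis by (simp add: power_sum)
qed

text \<open>Membership in \<open>Linfty\<close> supplies the upper bound without which a real
  \<open>SUP\<close> need not dominate the values.\<close>

lemma abs_le_sup_norm:
  assumes "f \<in> Linfty X" "y \<in> X"
  shows "\<bar>f y\<bar> \<le> sup_norm X f"
proof -
  obtain B where "\<And>z. z \<in> X \<Longrightarrow> \<bar>f z\<bar> \<le> B"
    using assms(1) by (auto simp: Linfty_def bounded_iff)
  then have "bdd_above ((\<lambda>z. \<bar>f z\<bar>) ` X)" by (auto intro!: bdd_aboveI2)
  then show ?thesis unfolding sup_norm_def using assms(2) by (intro cSUP_upper)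
qed

text \<open>Halving a coordinate of S costs a weight 4 and gains 1/16. Summing (1/4)^|T| over the
  subsets T of S gives (5/4)^|S|, and the denominator 3^|S| turns this into (5/12)^|S|.\<close>

lemma abs_extrapolated_remainder_le:
  assumes S: "S \<subseteq> {1..d}"
    and bound: "\<And>v. v \<in> unit_cube S \<Longrightarrow> \<bar>c x v\<bar> \<le> K"
  shows "\<bar>extrapolated d (\<lambda>h x. c x (restrict h S) * (\<Prod>i\<in>S. h i ^ 4)) (dyadic_mesh d j) x\<bar>
    \<le> K * (5 / 12) ^ card S * (1 / 16) ^ (\<Sum>i\<in>S. j i)"
proof -
  have fin: "finite S" using S finite_subset by blast
  \<comment> \<open>Absorbing the product into the coefficient makes the whole term a function of
    the restricted mesh, as \<open>extrapolated_restrict\<close> requires.\<close>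
  let ?c = "\<lambda>x v. c x v * (\<Prod>i\<in>S. v i ^ 4)"
  let ?q = "(1 / 16 :: real) ^ (\<Sum>i\<in>S. j i)"
  have term_le: "\<bar>(- 4) ^ card T * ?c x (restrict (halve_mesh d T (dyadic_mesh d j)) S)\<bar>
      \<le> K * ?q * (1 / 4) ^ card T" if "T \<subseteq> S" for T
  proof -
    let ?j = "\<lambda>i. j i + of_bool (i \<in> T)"
    have "(\<Sum>i\<in>S. ?j i) = (\<Sum>i\<in>S. j i) + card T"
      using that fin by (simp add: sum.distrib of_bool_def sum.If_cases Int_absorb1)
    then have "(\<Prod>i\<in>S. restrict (dyadic_mesh d ?j) S i ^ 4) = ?q * (1 / 16) ^ card T"
      using prod_dyadic_mesh_power4[OF S, of ?j] by (simp add: power_add)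
    then have "\<bar>(- 4) ^ card T * ?c x (restrict (dyadic_mesh d ?j) S)\<bar> =
        \<bar>c x (restrict (dyadic_mesh d ?j) S)\<bar> * (?q * (4 ^ card T * (1 / 16) ^ card T))"
      by (simp only: abs_mult power_abs) simp
    also have "4 ^ card T * (1 / 16) ^ card T = (1 / 4 :: real) ^ card T"
      unfolding power_mult_distrib[symmetric] by simp
    also have "\<bar>c x (restrict (dyadic_mesh d ?j) S)\<bar> * (?q * (1 / 4) ^ card T)
        \<le> K * (?q * (1 / 4) ^ card T)"
      using S by (intro mult_right_mono bound dyadic_mesh_in_unit_cube) auto
    also have "K * (?q * (1 / 4) ^ card T) = K * ?q * (1 / 4) ^ card T" by simp
    finally show ?thesis unfolding halve_mesh_dyadic_mesh .
  qed
  have eq: "extrapolated d (\<lambda>h x. c x (restrict h S) * (\<Prod>i\<in>S. h i ^ 4)) (dyadic_mesh d j) x =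
      extrapolated d (\<lambda>h x. ?c x (restrict h S)) (dyadic_mesh d j) x"
    by (intro extrapolated_cong arg_cong2[where f = "(*)"] prod.cong) auto
  have "\<bar>extrapolated d (\<lambda>h x. ?c x (restrict h S)) (dyadic_mesh d j) x\<bar> = \<bar>\<Sum>T\<in>Pow S. (- 4) ^ card T *
      ?c x (restrict (halve_mesh d T (dyadic_mesh d j)) S)\<bar> / 3 ^ card S"
    unfolding extrapolated_restrict[OF S, where c = ?c] by (simp add: abs_divide power_abs)
  also have "\<dots> \<le> (\<Sum>T\<in>Pow S. K * ?q * (1 / 4) ^ card T) / 3 ^ card S"
    using term_le by (intro divide_right_mono order_trans[OF sum_abs] sum_mono) auto
  also have "\<dots> = K * ?q * ((5 / 4) ^ card S / 3 ^ card S)"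
    unfolding sum_distrib_left[symmetric] sum_Pow_power_card[OF fin] by simp
  also have "(5 / 4) ^ card S / 3 ^ card S = (5 / 12 :: real) ^ card S"
    unfolding power_divide[symmetric] by simp
  finally show ?thesis unfolding eq by (simp only: mult_ac)
qed

lemma restrict_halve_mesh_dyadic_mesh_restrict:
  assumes "S \<subseteq> {1..d}"
  shows "restrict (halve_mesh d T (dyadic_mesh d (restrict j S))) S =
    restrict (halve_mesh d T (dyadic_mesh d j)) S"
  using assms by (auto simp: halve_mesh_def dyadic_mesh_def fun_eq_iff restrict_def)

text \<open>Outside S, \<open>restrict j S\<close> has the value \<open>undefined\<close>, but
  neither the coefficient nor the product reads those coordinates. This gives the summand the form
  needed for summing out.\<close>

lemma extrapolated_dyadic_mesh_restrict:
  assumes "S \<subseteq> {1..d}"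
  shows "extrapolated d (\<lambda>h x. c x (restrict h S) * (\<Prod>i\<in>S. h i ^ 4)) (dyadic_mesh d (restrict j S)) x =
    extrapolated d (\<lambda>h x. c x (restrict h S) * (\<Prod>i\<in>S. h i ^ 4)) (dyadic_mesh d j) x"
proof -
  note eq = restrict_halve_mesh_dyadic_mesh_restrict[OF assms]
  have "halve_mesh d T (dyadic_mesh d (restrict j S)) i = halve_mesh d T (dyadic_mesh d j) i"
    if "i \<in> S" for T i
    using fun_cong[OF eq, of T j i] that by simp
  then show ?thesis
    unfolding extrapolated_eq_sum_Pow eq
    by (intro arg_cong2[where f = "(/)"] sum.cong arg_cong2[where f = "(*)"] prod.cong refl) auto
qed

section \<open>The combination as an iterated difference\<close>

lemma forward_diff_diff:
  "forward_diff k (\<lambda>l. f l - g l) n = forward_diff k f n - forward_diff k g n"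
  by (simp add: forward_diff_eq_sum right_diff_distrib sum_subtractf)

lemma forward_diff_sum:
  "forward_diff k (\<lambda>l. \<Sum>i\<in>I. f i l) n = (\<Sum>i\<in>I. forward_diff k (f i) n)"
  unfolding forward_diff_eq_sum sum_distrib_left by (rule sum.swap)

lemma multi_indices_eq_weak_compositions: "multi_indices d l = weak_compositions {1..d} l"
  by (simp add: multi_indices_def weak_compositions_def)

lemma combination_solution_eq_forward_diff:
  assumes "d \<ge> 1"
  shows "combination_solution d uh n x = forward_diff (d - 1)
    (\<lambda>l. \<Sum>j\<in>weak_compositions {1..d} l. extrapolated d uh (dyadic_mesh d j) x) n"
proof -
  \<comment> \<open>Substitution l = n + i; d \<ge> 1 makes the truncated subtraction exact.\<close>
  have "{n..n + d - 1} = (\<lambda>i. n + i) ` {..d - 1}"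
    using image_add_atLeastAtMost[of n 0 "d - 1"] assms
    by (simp add: atLeast0AtMost add.commute)
  then show ?thesis
    unfolding combination_solution_def forward_diff_eq_sum multi_indices_eq_weak_compositions
    by (simp add: sum.reindex combination_coeff_def)
qed

text \<open>Regard the constant as a function of the first coordinate: all d - 1 differences cancel,
  and over {1} each level has a single multi-index.\<close>

lemma forward_diff_weak_compositions_const:
  assumes "d \<ge> 1"
  shows "forward_diff (d - 1) (\<lambda>l. \<Sum>j\<in>weak_compositions {1..d} l. c) n = c"
  using forward_diff_weak_compositions[of "{1..d}" "{1}" "\<lambda>_. c" n] assms
    card_weak_compositions[of "{1::nat}"]
  by simp

lemma abs_forward_diff_weak_compositions_le:
  fixes g :: "(nat \<Rightarrow> nat) \<Rightarrow> real"
  assumes S: "S \<subseteq> {1..d}" "S \<noteq> {}" and C: "0 \<le> C"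
    and g: "\<And>j. \<bar>g j\<bar> \<le> C * (1 / 16) ^ (\<Sum>i\<in>S. j i)"
  shows "\<bar>forward_diff (d - 1) (\<lambda>l. \<Sum>j\<in>weak_compositions {1..d} l. g (restrict j S)) n\<bar> \<le>
    real (n + 2 * d - 1) ^ (d - 1) / fact (d - 1) * C * (1 / 16) ^ n * (17 / 16) ^ (card S - 1)"
proof -
  have fin: "finite S" using S finite_subset by blast
  have cS: "0 < card S" "card S \<le> d"
    using S fin card_mono[of "{1..d}" S] by (auto simp: card_gt_0_iff)
  have cD: "card ({1..d} - S) = d - card S" using S fin by (simp add: card_Diff_subset)
  let ?P = "real (n + 2 * d - 1) ^ (d - 1) / fact (d - 1)"
  have "\<bar>\<Sum>j\<in>weak_compositions S (n + (d - card S) + i). g j\<bar> \<le> ?P * C * (1 / 16) ^ n * (1 / 16) ^ i"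
    if "i \<le> card S - 1" for i
  proof -
    let ?l = "n + (d - card S) + i"
    have "\<bar>\<Sum>j\<in>weak_compositions S ?l. g j\<bar> \<le> (\<Sum>j\<in>weak_compositions S ?l. C * (1 / 16) ^ ?l)"
    proof (intro order_trans[OF sum_abs] sum_mono)
      fix j assume "j \<in> weak_compositions S ?l"
      then show "\<bar>g j\<bar> \<le> C * (1 / 16) ^ ?l"
        using g[of j] by (simp add: weak_compositions_def)
    qed
    also have "\<dots> = real ((?l + card S - 1) choose (card S - 1)) * (C * (1 / 16) ^ ?l)"
      using card_weak_compositions[OF fin S(2)] by simp
    \<comment> \<open>The upper index is n + d + i - 1 with i < d, hence at most n + 2d - 1. The
      decay factor from the shift d - |S| is discarded.\<close>
    also have "\<dots> \<le> ?P * (C * (1 / 16) ^ (n + i))"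
      using that cS C
      by (intro mult_mono binomial_le_power_over_fact mult_left_mono power_decreasing) auto
    finally show ?thesis by (simp add: power_add mult_ac)
  qed
  then have "\<bar>forward_diff (card S - 1) (\<lambda>l. \<Sum>j\<in>weak_compositions S l. g j) (n + (d - card S))\<bar> \<le>
      ?P * C * (1 / 16) ^ n * (1 + 1 / 16) ^ (card S - 1)"
    by (intro abs_forward_diff_geometric_le) auto
  moreover have "forward_diff (d - 1) (\<lambda>l. \<Sum>j\<in>weak_compositions {1..d} l. g (restrict j S)) n =
      forward_diff (card S - 1) (\<lambda>l. \<Sum>j\<in>weak_compositions S l. g j) (n + (d - card S))"
    using forward_diff_weak_compositions[OF _ S, of g n] by (simp only: cD card_atLeastAtMost) simp
  ultimately show ?thesis by simp
qed

section \<open>The error bound for the combination solution\<close>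

theorem corollary2p6:
  fixes d :: nat
    and u :: "(nat \<Rightarrow> real) \<Rightarrow> real"
    and uh :: "(nat \<Rightarrow> real) \<Rightarrow> (nat \<Rightarrow> real) \<Rightarrow> real"
    and \<beta> :: "nat \<Rightarrow> (nat \<Rightarrow> real) \<times> (nat \<Rightarrow> real) \<Rightarrow> real"
    and \<gamma> :: "nat set \<Rightarrow> (nat \<Rightarrow> real) \<times> (nat \<Rightarrow> real) \<Rightarrow> real"
    and K :: real
  assumes "d \<ge> 1"
    and "\<And>j. j \<in> {1..d} \<Longrightarrow> \<beta> j \<in> Linfty (unit_cube {1..d} \<times> unit_cube ({1..d} - {j}))"
    and "\<And>m S. m \<in> {1..d} \<Longrightarrow> S \<in> subsets_of_card d m \<Longrightarrow>
           \<gamma> S \<in> Linfty (unit_cube {1..d} \<times> unit_cube S)"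
    and "\<And>m S. m \<in> {1..d} \<Longrightarrow> S \<in> subsets_of_card d m \<Longrightarrow>
           sup_norm (unit_cube {1..d} \<times> unit_cube S) (\<gamma> S) \<le> K"
    and "\<And>h x. h \<in> mesh_vectors d \<Longrightarrow> x \<in> unit_cube {1..d} \<Longrightarrow>
           u x - uh h x =
             (\<Sum>j=1..d. \<beta> j (x, restrict h ({1..d} - {j})) * h j ^ 2) +
             (\<Sum>m=1..d. \<Sum>S\<in>subsets_of_card d m. \<gamma> S (x, restrict h S) * (\<Prod>j\<in>S. h j ^ 4))"
  shows "\<forall>n. \<forall>x\<in>unit_cube {1..d}.
           \<bar>u x - combination_solution d uh n x\<bar> \<le>
             10 / 3 * (K / fact (d - 1)) * (85 / 24) ^ (d - 1) *
             real (n + 2 * d - 1) ^ (d - 1) * 2 powi (- 4 * int n)"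
proof (intro allI ballI)
  fix n :: nat and x :: "nat \<Rightarrow> real"
  assume x: "x \<in> unit_cube {1..d}"
  note d = assms(1)
  define \<S> where "\<S> = {S. S \<subseteq> {1..d} \<and> 1 \<le> card S}"
  have \<S>: "finite \<S>" "\<And>S. S \<in> \<S> \<Longrightarrow> S \<subseteq> {1..d}" "\<And>S. S \<in> \<S> \<Longrightarrow> S \<noteq> {}"
    by (auto simp: \<S>_def)
  have \<gamma>_le: "\<bar>\<gamma> S (x, v)\<bar> \<le> K" if "S \<in> \<S>" "v \<in> unit_cube S" for S v
  proof -
    have "card S \<in> {1..d}" "S \<in> subsets_of_card d (card S)"
      using that card_mono[of "{1..d}" S] by (auto simp: \<S>_def subsets_of_card_def)
    from abs_le_sup_norm[OF assms(3)[OF this], of "(x, v)"] assms(4)[OF this]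
    show ?thesis using x that by simp
  qed
  \<comment> \<open>One instance of the bound on \<gamma> shows K \<ge> 0; {1} is admissible because
    d \<ge> 1.\<close>
  have "{1} \<in> \<S>" "(\<lambda>i\<in>{1}. 0) \<in> unit_cube {1}"
    using d by (auto simp: \<S>_def unit_cube_def)
  from order_trans[OF abs_ge_zero \<gamma>_le[OF this]] have K: "0 \<le> K" .
  define R where "R S h z = \<gamma> S (z, restrict h S) * (\<Prod>i\<in>S. h i ^ 4)" for S h and z :: "nat \<Rightarrow> real"
  define e where "e S j = extrapolated d (R S) (dyadic_mesh d j) x" for S j

  have error: "u x - extrapolated d uh (dyadic_mesh d j) x = (\<Sum>S\<in>\<S>. e S (restrict j S))" for j
  proof -
    let ?h = "dyadic_mesh d j"
    let ?B = "\<lambda>i h z. \<beta> i (z, restrict h ({1..d} - {i})) * h i ^ 2"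
    have "u x - extrapolated d uh ?h x = extrapolated d (\<lambda>h z. u z - uh h z) ?h x"
      by (simp add: extrapolated_diff extrapolated_const)
    also have "\<dots> = extrapolated d (\<lambda>h z. (\<Sum>i=1..d. ?B i h z) + (\<Sum>S\<in>\<S>. R S h z)) ?h x"
    proof (rule extrapolated_cong)
      fix T
      let ?h' = "halve_mesh d T ?h"
      \<comment> \<open>Halving raises dyadic exponents by one, so the assumed expansion applies at
        every mesh in the extrapolation.\<close>
      have "?h' \<in> mesh_vectors d"
        by (simp add: halve_mesh_dyadic_mesh dyadic_mesh_in_mesh_vectors)
      from assms(5)[OF this x]
      show "u x - uh ?h' x = (\<Sum>i=1..d. ?B i ?h' x) + (\<Sum>S\<in>\<S>. R S ?h' x)"
        unfolding sum_subsets_of_card R_def \<S>_def .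
    qed
    also have "\<dots> = (\<Sum>i=1..d. extrapolated d (?B i) ?h x) + (\<Sum>S\<in>\<S>. e S j)"
      by (simp only: extrapolated_add extrapolated_sum e_def)
    also have "(\<Sum>i=1..d. extrapolated d (?B i) ?h x) = 0"
    proof (intro sum.neutral ballI)
      fix i assume "i \<in> {1..d}"
      then show "extrapolated d (?B i) ?h x = 0"
        by (rule extrapolated_square_eq_0[where b = "\<lambda>z v. \<beta> i (z, v)"])
    qed
    also have "(\<Sum>S\<in>\<S>. e S j) = (\<Sum>S\<in>\<S>. e S (restrict j S))"
    proof (intro sum.cong refl)
      fix S assume "S \<in> \<S>"
      then show "e S j = e S (restrict j S)"
        unfolding e_def R_def
        using extrapolated_dyadic_mesh_restrict[OF \<S>(2), where c = "\<lambda>z v. \<gamma> S (z, v)"]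
        by simp
    qed
    finally show ?thesis by simp
  qed

  let ?\<Delta> = "\<lambda>S. forward_diff (d - 1) (\<lambda>l. \<Sum>j\<in>weak_compositions {1..d} l. e S (restrict j S)) n"
  let ?P = "real (n + 2 * d - 1) ^ (d - 1) / fact (d - 1)"
  \<comment> \<open>The combination reproduces constants, so u x may be moved inside the
    differences.\<close>
  have "u x - combination_solution d uh n x = forward_diff (d - 1)
      (\<lambda>l. \<Sum>j\<in>weak_compositions {1..d} l. u x - extrapolated d uh (dyadic_mesh d j) x) n"
    unfolding combination_solution_eq_forward_diff[OF d] sum_subtractf forward_diff_diff
    using forward_diff_weak_compositions_const[OF d] by simp
  also have "\<dots> = forward_diff (d - 1)
      (\<lambda>l. \<Sum>S\<in>\<S>. \<Sum>j\<in>weak_compositions {1..d} l. e S (restrict j S)) n"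
    unfolding error by (subst sum.swap) (rule refl)
  also have "\<dots> = (\<Sum>S\<in>\<S>. ?\<Delta> S)" by (rule forward_diff_sum)
  finally have "\<bar>u x - combination_solution d uh n x\<bar> \<le> (\<Sum>S\<in>\<S>. \<bar>?\<Delta> S\<bar>)"
    by simp
  also have "\<dots> \<le> (\<Sum>S\<in>\<S>. ?P * K * (1 / 16) ^ n * (1 / 2) ^ card S)"
  proof (rule sum_mono)
    fix S assume "S \<in> \<S>"
    note S = \<open>S \<in> \<S>\<close> \<S>(2,3)[OF \<open>S \<in> \<S>\<close>]
    have "\<bar>e S j\<bar> \<le> K * (5 / 12) ^ card S * (1 / 16) ^ (\<Sum>i\<in>S. j i)" for j
      unfolding e_def R_def
      by (rule abs_extrapolated_remainder_le[where c = "\<lambda>z v. \<gamma> S (z, v)"])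
        (use S \<gamma>_le in auto)
    then have "\<bar>?\<Delta> S\<bar> \<le> ?P * (K * (5 / 12) ^ card S) * (1 / 16) ^ n * (17 / 16) ^ (card S - 1)"
      using S K by (intro abs_forward_diff_weak_compositions_le) auto
    also have "\<dots> = ?P * K * (1 / 16) ^ n * ((5 / 12) ^ card S * (17 / 16) ^ (card S - 1))"
      by (simp add: mult_ac)
    also have "\<dots> \<le> ?P * K * (1 / 16) ^ n * (1 / 2) ^ card S"
    proof (rule mult_left_mono)
      \<comment> \<open>One more factor 17/16 aligns the exponents; then 5/12 * 17/16 = 85/192 \<le>
        1/2.\<close>
      have "(5 / 12) ^ card S * (17 / 16) ^ (card S - 1) \<le> (5 / 12 :: real) ^ card S * (17 / 16) ^ card S"
        by (intro mult_left_mono power_increasing) auto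
      also have "\<dots> \<le> (1 / 2) ^ card S"
        unfolding power_mult_distrib[symmetric] by (intro power_mono) auto
      finally show "(5 / 12) ^ card S * (17 / 16) ^ (card S - 1) \<le> (1 / 2 :: real) ^ card S" .
    qed (use K in auto)
    finally show "\<bar>?\<Delta> S\<bar> \<le> ?P * K * (1 / 16) ^ n * (1 / 2) ^ card S" .
  qed
  also have "\<dots> = ?P * K * (1 / 16) ^ n * (\<Sum>S\<in>\<S>. (1 / 2) ^ card S)"
    by (simp only: sum_distrib_left)
  also have "\<dots> \<le> ?P * K * (1 / 16) ^ n * (10 / 3 * (85 / 24) ^ (d - 1))"
  proof (rule mult_left_mono)
    \<comment> \<open>Adding the empty set completes the power set, whose sum is (1 + 1/2)^d.
      Splitting off one factor leaves the comparisons 3/2 \<le> 10/3 and 3/2 \<le> 85/24.\<close>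
    have "(\<Sum>S\<in>\<S>. (1 / 2) ^ card S) \<le> (\<Sum>S\<in>Pow {1..d}. (1 / 2 :: real) ^ card S)"
      by (rule sum_mono2) (auto simp: \<S>_def)
    also have "\<dots> = (3 / 2) ^ Suc (d - 1)"
      using d by (simp add: sum_Pow_power_card)
    also have "\<dots> = 3 / 2 * (3 / 2) ^ (d - 1)" by simp
    also have "\<dots> \<le> 10 / 3 * (85 / 24) ^ (d - 1)"
      by (intro mult_mono power_mono) auto
    finally show "(\<Sum>S\<in>\<S>. (1 / 2) ^ card S) \<le> (10 / 3 * (85 / 24) ^ (d - 1) :: real)" .
  qed (use K in auto)
  also have "(1 / 16 :: real) ^ n = 2 powi (- 4 * int n)"
  proof -
    have "(2 :: real) powi (- 4 * int n) = inverse (2 powi int (4 * n))"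
      by (simp add: power_int_minus)
    also have "\<dots> = inverse (16 ^ n)" by (simp only: power_int_of_nat power_mult) simp
    finally show ?thesis by (simp add: power_one_over inverse_eq_divide)
  qed
  finally show "\<bar>u x - combination_solution d uh n x\<bar> \<le>
      10 / 3 * (K / fact (d - 1)) * (85 / 24) ^ (d - 1) *
      real (n + 2 * d - 1) ^ (d - 1) * 2 powi (- 4 * int n)"
    by (simp add: mult_ac)
qed

end
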